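(* Let $d\ge 1$ be the dimension, let $q\ge d$ be an integer, and let the nodes $x^i_k$, the one-dimensional basis functions $u^i_k$, the grid-point errors $\epsilon^{\mathbf i}_{\mathbf k}$, the propagated error function $e_{\text{BVP}}$ on $[0,1]^d$, and the quantities $\Lambda_i$ and $S_l$ be as defined in the context. (i) Suppose $\epsilon>0$ is an upper bound of the numerical error at each grid point, i.e. $|\epsilon^{\mathbf i}_{\mathbf k}|<\epsilon$ for all multi-indices $\mathbf i$ with $|\mathbf i|\le q$ and all $1\le \mathbf k\le N_{\mathbf i}$. Then $$\|e_{\text{BVP}}\|_{L^\infty} < \epsilon \sum_{l=q-d+1}^{q}\binom{d-1}{q-l}\,S_l .$$ (ii) With $\epsilon$ as in (i), suppose that $\tilde\Lambda_q>0$ is a constant such that $$\Lambda_i\le \tilde\Lambda_q\qquad (1\le i\le q-d+1).$$ Then $$\frac{\|e_{\text{BVP}}\|_{L^\infty}}{\epsilon}=O\!\left((\log N)^{d-1}\,\tilde\Lambda_q^{\,d}\right),$$ where $N=2^{q-d}$ (so that $N+1=2^{q-d}+1$ is the number of grid points in each dimension). Here the $O$-notation refers to $q\to\infty$ with $d$ and the family of nodes and basis functions fixed; the implied constant does not depend on $q$, $\epsilon$, $\tilde\Lambda_q$ or the errors $\epsilon^{\mathbf i}_{\mathbf k}$.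
   Context: Nodes. For each integer $i\ge 1$, $X^i=\{x^i_1,\dots,x^i_{N_i}\}\subset[0,1]$ is a finite set of $N_i$ distinct points, and the sets are nested: $X^{i-1}\subset X^i$ for $i>1$. In the paper's grids $N_i=2^{i-1}+1$ for $i\ge 2$. Basis functions. For each $i\ge1$ and $1\le k\le N_i$, $u^i_k:[0,1]\to\mathbb R$ is a continuous function with $u^i_k(x^i_k)=1$ and $u^i_k(x)=0$ for $x\in X^i$, $x\ne x^i_k$ (for example piecewise linear hat functions or Lagrange polynomials). Multi-indices. $\mathbf i=(i_1,\dots,i_d)$ with all $i_j\ge1$, $|\mathbf i|=i_1+\cdots+i_d$; $1\le\mathbf k\le N_{\mathbf i}$ means $1\le k_j\le N_{i_j}$ for $j=1,\dots,d$; $x^{\mathbf i}_{\mathbf k}=(x^{i_1}_{k_1},\dots,x^{i_d}_{k_d})$; and $(u^{i_1}_{k_1}\otimes\cdots\otimes u^{i_d}_{k_d})(x_1,\dots,x_d)=u^{i_1}_{k_1}(x_1)\cdots u^{i_d}_{k_d}(x_d)$. Sparse grid. With $\Delta X^1=X^1$, $\Delta X^i=X^i\setminus X^{i-1}$ for $i\ge2$, and $\Delta X^{\mathbf i}=\Delta X^{i_1}\times\cdots\times\Delta X^{i_d}$, the sparse grid is $G^q_{\text{sparse}}=\bigcup_{|\mathbf i|\le q}\Delta X^{\mathbf i}$ (it contains every $x^{\mathbf i}_{\mathbf k}$ with $|\mathbf i|\le q$). Errors. A function $V$ on $[0,1]^d$ (a value function at a fixed time) is approximated at every sparse grid point by a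 numerical value $\bar V$. For $|\mathbf i|\le q$ put $\epsilon^{\mathbf i}_{\mathbf k}=\bar V(x^{\mathbf i}_{\mathbf k})-V(x^{\mathbf i}_{\mathbf k})$. The sparse grid interpolation operator is $$\mathcal I^q(f)=\sum_{q-d+1\le|\mathbf i|\le q}\ \sum_{1\le\mathbf k\le N_{\mathbf i}}(-1)^{q-|\mathbf i|}\binom{d-1}{q-|\mathbf i|}f(x^{\mathbf i}_{\mathbf k})\,u^{i_1}_{k_1}\otimes\cdots\otimes u^{i_d}_{k_d},$$ and $e_{\text{BVP}}=\mathcal I^q(\bar V)-\mathcal I^q(V)$, that is, $$e_{\text{BVP}}=\sum_{q-d+1\le|\mathbf i|\le q}\ \sum_{1\le\mathbf k\le N_{\mathbf i}}(-1)^{q-|\mathbf i|}\binom{d-1}{q-|\mathbf i|}\,\epsilon^{\mathbf i}_{\mathbf k}\,u^{i_1}_{k_1}\otimes\cdots\otimes u^{i_d}_{k_d}.$$ $\|\cdot\|_{L^\infty}$ is the supremum norm on $[0,1]^d$. Constants. $\Lambda_i=\max_{x\in[0,1]}\sum_{k=1}^{N_i}|u^i_k(x)|$ for $i\ge1$, and $S_l=\sum_{|\mathbf i|=l}\Lambda_{i_1}\Lambda_{i_2}\cdots\Lambda_{i_d}$ for integers $l\ge d$, the sum being over multi-indices with all $i_j\ge1$; for $l<d$ this sum is empty and $S_l=0$. *)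

theory Defs
  imports "HOL-Analysis.Analysis"
begin

(* The dimension d is CARD('d). A multi-index is a function 'd => nat, and the points of the unit
   cube [0,1]^d are the elements of cbox 0 1 :: (real ^ 'd) set.
   A family of one-dimensional grids is given by the numbers of nodes N i and the nodes x i k,
   where i >= 1 and 1 <= k <= N i; values outside these ranges are never used. *)

definition nodes :: "(nat \<Rightarrow> nat) \<Rightarrow> (nat \<Rightarrow> nat \<Rightarrow> real) \<Rightarrow> nat \<Rightarrow> real set" where
  "nodes N x i = x i ` {1..N i}"

definition multi_indices :: "('d \<Rightarrow> nat) set" where
  "multi_indices = {i. \<forall>j. 1 \<le> i j}"

definition msize :: "('d::finite \<Rightarrow> nat) \<Rightarrow> nat" where
  "msize i = (\<Sum>j\<in>UNIV. i j)"

definition node_indices :: "(nat \<Rightarrow> nat) \<Rightarrow> ('d \<Rightarrow> nat) \<Rightarrow> ('d \<Rightarrow> nat) set" where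
  "node_indices N i = {k. \<forall>j. 1 \<le> k j \<and> k j \<le> N (i j)}"

definition grid_point ::
    "(nat \<Rightarrow> nat \<Rightarrow> real) \<Rightarrow> ('d::finite \<Rightarrow> nat) \<Rightarrow> ('d \<Rightarrow> nat) \<Rightarrow> real ^ 'd" where
  "grid_point x i k = (\<chi> j. x (i j) (k j))"

definition tensor_basis ::
    "(nat \<Rightarrow> nat \<Rightarrow> real \<Rightarrow> real) \<Rightarrow> ('d::finite \<Rightarrow> nat) \<Rightarrow> ('d \<Rightarrow> nat) \<Rightarrow> real ^ 'd \<Rightarrow> real" where
  "tensor_basis u i k y = (\<Prod>j\<in>UNIV. u (i j) (k j) (y $ j))"

(* Only used for q >= CARD('d), so the subtractions are not truncated. *)
definition sparse_interp ::
    "(nat \<Rightarrow> nat) \<Rightarrow> (nat \<Rightarrow> nat \<Rightarrow> real) \<Rightarrow> (nat \<Rightarrow> nat \<Rightarrow> real \<Rightarrow> real) \<Rightarrow> nat \<Rightarrow>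
      (real ^ 'd \<Rightarrow> real) \<Rightarrow> real ^ 'd::finite \<Rightarrow> real" where
  "sparse_interp N x u q f y =
     (\<Sum>i | i \<in> multi_indices \<and> q - CARD('d) + 1 \<le> msize i \<and> msize i \<le> q.
       \<Sum>k\<in>node_indices N i.
         (-1) ^ (q - msize i) * real ((CARD('d) - 1) choose (q - msize i)) *
         f (grid_point x i k) * tensor_basis u i k y)"

(* W holds the numerical values approximating V; only its values at grid points matter. *)
definition grid_error ::
    "(nat \<Rightarrow> nat \<Rightarrow> real) \<Rightarrow> (real ^ 'd \<Rightarrow> real) \<Rightarrow> (real ^ 'd \<Rightarrow> real) \<Rightarrow>
      ('d::finite \<Rightarrow> nat) \<Rightarrow> ('d \<Rightarrow> nat) \<Rightarrow> real" where
  "grid_error x V W i k = W (grid_point x i k) - V (grid_point x i k)"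

definition e_BVP ::
    "(nat \<Rightarrow> nat) \<Rightarrow> (nat \<Rightarrow> nat \<Rightarrow> real) \<Rightarrow> (nat \<Rightarrow> nat \<Rightarrow> real \<Rightarrow> real) \<Rightarrow> nat \<Rightarrow>
      (real ^ 'd \<Rightarrow> real) \<Rightarrow> (real ^ 'd \<Rightarrow> real) \<Rightarrow> real ^ 'd::finite \<Rightarrow> real" where
  "e_BVP N x u q V W y = sparse_interp N x u q W y - sparse_interp N x u q V y"

lemma e_BVP_eq:
  "e_BVP N x u q V W (y :: real ^ 'd::finite) =
     (\<Sum>i | i \<in> multi_indices \<and> q - CARD('d) + 1 \<le> msize i \<and> msize i \<le> q.
       \<Sum>k\<in>node_indices N i.
         (-1) ^ (q - msize i) * real ((CARD('d) - 1) choose (q - msize i)) *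
         grid_error x V W i k * tensor_basis u i k y)"
  unfolding e_BVP_def sparse_interp_def grid_error_def sum_subtractf [symmetric]
    right_diff_distrib left_diff_distrib ..

definition sup_norm :: "(real ^ 'd \<Rightarrow> real) \<Rightarrow> real" where
  "sup_norm f = (SUP y\<in>cbox 0 1. \<bar>f y\<bar>)"

definition Lebesgue_const ::
    "(nat \<Rightarrow> nat) \<Rightarrow> (nat \<Rightarrow> nat \<Rightarrow> real \<Rightarrow> real) \<Rightarrow> nat \<Rightarrow> real" where
  "Lebesgue_const N u i = (SUP t\<in>{0..1}. \<Sum>k = 1..N i. \<bar>u i k t\<bar>)"

(* For continuous basis functions the supremum is a maximum. *)
lemma Lebesgue_const_is_max:
  assumes "\<And>k. 1 \<le> k \<Longrightarrow> k \<le> N i \<Longrightarrow> continuous_on {0..1} (u i k)"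
  shows "\<exists>t\<in>{0..1}. Lebesgue_const N u i = (\<Sum>k = 1..N i. \<bar>u i k t\<bar>)"
    and "\<And>s. s \<in> {0..1} \<Longrightarrow> (\<Sum>k = 1..N i. \<bar>u i k s\<bar>) \<le> Lebesgue_const N u i"
proof -
  have "continuous_on {0..1} (\<lambda>t. \<Sum>k = 1..N i. \<bar>u i k t\<bar>)"
    by (intro continuous_on_sum continuous_on_rabs assms) simp_all
  then have "\<exists>t\<in>{0..1}. \<forall>s\<in>{0..1}. (\<Sum>k = 1..N i. \<bar>u i k s\<bar>) \<le> (\<Sum>k = 1..N i. \<bar>u i k t\<bar>)"
    by (intro continuous_attains_sup) auto
  then obtain t where t: "t \<in> {0..1}"
      "\<And>s. s \<in> {0..1} \<Longrightarrow> (\<Sum>k = 1..N i. \<bar>u i k s\<bar>) \<le> (\<Sum>k = 1..N i. \<bar>u i k t\<bar>)"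
    by blast
  then have eq: "Lebesgue_const N u i = (\<Sum>k = 1..N i. \<bar>u i k t\<bar>)"
    unfolding Lebesgue_const_def by (intro cSup_eq_maximum) auto
  show "\<exists>t\<in>{0..1}. Lebesgue_const N u i = (\<Sum>k = 1..N i. \<bar>u i k t\<bar>)"
    using t eq by blast
  show "\<And>s. s \<in> {0..1} \<Longrightarrow> (\<Sum>k = 1..N i. \<bar>u i k s\<bar>) \<le> Lebesgue_const N u i"
    using t eq by simp
qed

(* The type argument carries the dimension. *)
definition Lebesgue_sum ::
    "'d::finite itself \<Rightarrow> (nat \<Rightarrow> nat) \<Rightarrow> (nat \<Rightarrow> nat \<Rightarrow> real \<Rightarrow> real) \<Rightarrow> nat \<Rightarrow> real" where
  "Lebesgue_sum _ N u l =
     (\<Sum>i | (i :: 'd \<Rightarrow> nat) \<in> multi_indices \<and> msize i = l.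
       \<Prod>j\<in>UNIV. Lebesgue_const N u (i j))"

end

(* The triangle inequality bounds the sparse interpolant by the sum over the multi-indices of
   binomial coefficients times tensor Lebesgue functions, and each of the latter factorises into
   one-dimensional Lebesgue functions. The bound in (i) is strict because there are only finitely
   many grid-point errors, so their maximum is still below \<epsilon>, and because S_q > 0, every Lebesgue
   constant being at least 1. For (ii), a multi-index of size l is determined by all but one of its
   components, each of which is at most q - d + 1, so S_l has at most (q - d + 1)^(d - 1)
   summands, each at most L^d. *)

theory Submission
  imports Defs
begin

section \<open>Multi-indices of bounded size: range of components and count\<close>

text \<open>The other d - 1 components are each at least 1. So for q >= d a size of at most q
  confines every component to the levels 1, ..., q - d + 1, the range in which (ii) bounds the
  Lebesgue constants.\<close>

lemma member_le_msize:
  fixes i :: "'d::finite \<Rightarrow> nat"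
  assumes "i \<in> multi_indices"
  shows "i j + (CARD('d) - 1) \<le> msize i"
proof -
  have "CARD('d) - 1 = (\<Sum>k\<in>UNIV - {j}. 1)"
    by (simp add: card_Diff_singleton)
  also have "\<dots> \<le> (\<Sum>k\<in>UNIV - {j}. i k)"
    using assms by (intro sum_mono) (simp add: multi_indices_def)
  finally show ?thesis
    by (simp add: msize_def sum.remove[of UNIV j])
qed

lemma finite_multi_indices_le:
  "finite {i :: 'd::finite \<Rightarrow> nat. i \<in> multi_indices \<and> msize i \<le> q}"
proof (rule finite_subset)
  show "{i. i \<in> multi_indices \<and> msize i \<le> q} \<subseteq> PiE (UNIV :: 'd set) (\<lambda>_. {0..q})"
  proof clarify
    fix i :: "'d \<Rightarrow> nat" assume "i \<in> multi_indices" "msize i \<le> q"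
    then have "i j \<le> q" for j
      using member_le_msize[of i j] by linarith
    then show "i \<in> PiE UNIV (\<lambda>_. {0..q})" by auto
  qed
qed (auto intro: finite_PiE)

lemma finite_multi_indices_eq:
  "finite {i :: 'd::finite \<Rightarrow> nat. i \<in> multi_indices \<and> msize i = l}"
  by (rule finite_subset[OF _ finite_multi_indices_le[of l]]) auto

text \<open>For l >= d the exact count is (l - 1) choose (d - 1). The cruder bound is uniform in l
  <= q and, for fixed d, has the same order in q as the exact count at l = q.\<close>

lemma card_multi_indices_eq_le:
  assumes "l \<le> q"
  shows "card {i :: 'd::finite \<Rightarrow> nat. i \<in> multi_indices \<and> msize i = l}
           \<le> (q - CARD('d) + 1) ^ (CARD('d) - 1)"
proof -
  fix j :: 'd
  let ?A = "{i :: 'd \<Rightarrow> nat. i \<in> multi_indices \<and> msize i = l}"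
  let ?P = "PiE (UNIV - {j}) (\<lambda>_. {1..q - CARD('d) + 1})"
  have "inj_on (\<lambda>i. restrict i (UNIV - {j})) ?A"
  proof (rule inj_onI)
    fix f g assume fg: "f \<in> ?A" "g \<in> ?A" "restrict f (UNIV - {j}) = restrict g (UNIV - {j})"
    have off: "f k = g k" if "k \<noteq> j" for k
      using fun_cong[OF fg(3), of k] that by simp
    have "(\<Sum>k\<in>UNIV - {j}. f k) = (\<Sum>k\<in>UNIV - {j}. g k)"
      using off by (intro sum.cong) auto
    then have "f j = g j"
      using fg by (simp add: msize_def sum.remove[of UNIV j])
    with off show "f = g" by (intro ext) (case_tac "x = j"; simp)
  qed
  moreover have "(\<lambda>i. restrict i (UNIV - {j})) ` ?A \<subseteq> ?P"
  proof clarify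
    fix f :: "'d \<Rightarrow> nat" assume f: "f \<in> multi_indices" "l = msize f"
    \<comment> \<open>Since \<open>f k\<close> is at least 1, the size bound forces d <= q, so
      \<open>q - CARD('d)\<close> is not truncated here.\<close>
    have "1 \<le> f k \<and> f k \<le> q - CARD('d) + 1" for k
      using f assms member_le_msize[of f k] by (auto simp: multi_indices_def)
    then show "restrict f (UNIV - {j}) \<in> ?P" by auto
  qed
  ultimately have "card ?A \<le> card ?P"
    by (intro card_inj_on_le) (auto intro: finite_PiE)
  also have "\<dots> = (q - CARD('d) + 1) ^ (CARD('d) - 1)"
    by (simp add: card_PiE card_Diff_singleton)
  finally show ?thesis .
qed

section \<open>Factorisation of the tensor Lebesgue function\<close>

lemma node_indices_eq_PiE: "node_indices N i = PiE UNIV (\<lambda>j. {1..N (i j)})"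
  by (auto simp: node_indices_def PiE_def)

lemma finite_node_indices: "finite (node_indices N (i :: 'd::finite \<Rightarrow> nat))"
  unfolding node_indices_eq_PiE by (intro finite_PiE) auto

text \<open>Expanding the product of the one-dimensional sums chooses one node index per coordinate,
  that is, one \<open>k\<close> in \<open>node_indices N i\<close>.\<close>

lemma sum_abs_tensor_basis:
  "(\<Sum>k\<in>node_indices N i. \<bar>tensor_basis u i k y\<bar>)
     = (\<Prod>j\<in>UNIV. \<Sum>k = 1..N (i j). \<bar>u (i j) k (y $ j)\<bar>)"
  unfolding node_indices_eq_PiE tensor_basis_def abs_prod
  by (rule prod_sum_PiE[symmetric]) auto

section \<open>Bounds for the sums S_l\<close>

lemma Lebesgue_sum_nonneg:
  assumes "\<And>i. 1 \<le> i \<Longrightarrow> 0 \<le> Lebesgue_const N u i"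
  shows "0 \<le> Lebesgue_sum TYPE('d::finite) N u l"
  unfolding Lebesgue_sum_def
  by (intro sum_nonneg prod_nonneg) (auto simp: multi_indices_def assms)

lemma Lebesgue_sum_pos:
  assumes pos: "\<And>i. 1 \<le> i \<Longrightarrow> 0 < Lebesgue_const N u i" and l: "CARD('d::finite) \<le> l"
  shows "0 < Lebesgue_sum TYPE('d) N u l"
proof -
  fix j :: 'd
  \<comment> \<open>A single multi-index of size l makes the sum positive. With all other components
    equal to 1, component \<open>j\<close> must be l - d + 1, which is at least 1 because d <=
    l.\<close>
  let ?i = "(\<lambda>k. 1)(j := l - CARD('d) + 1)"
  have "(\<Sum>k\<in>UNIV - {j}. ?i k) = (\<Sum>k\<in>UNIV - {j}. 1)"
    by (intro sum.cong) auto
  also have "\<dots> = CARD('d) - 1"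
    by (simp add: card_Diff_singleton)
  finally have "msize ?i = l"
    using l zero_less_card_finite[where 'a='d]
    by (simp add: msize_def sum.remove[of UNIV j] del: zero_less_card_finite)
  then have "?i \<in> {i. i \<in> multi_indices \<and> msize i = l}"
    by (simp add: multi_indices_def)
  moreover have "0 < (\<Prod>k\<in>UNIV. Lebesgue_const N u (f k))" if "f \<in> multi_indices" for f :: "'d \<Rightarrow> nat"
    using that by (intro prod_pos) (auto simp: multi_indices_def pos)
  ultimately show ?thesis
    unfolding Lebesgue_sum_def by (intro sum_pos finite_multi_indices_eq) auto
qed

lemma Lebesgue_sum_le:
  assumes nonneg: "\<And>i. 1 \<le> i \<Longrightarrow> 0 \<le> Lebesgue_const N u i"
    and le: "\<And>i. 1 \<le> i \<Longrightarrow> i \<le> q - CARD('d) + 1 \<Longrightarrow> Lebesgue_const N u i \<le> L"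
    and "0 \<le> L" "l \<le> q"
  shows "Lebesgue_sum TYPE('d::finite) N u l
           \<le> (real (q - CARD('d)) + 1) ^ (CARD('d) - 1) * L ^ CARD('d)"
proof -
  let ?A = "{i :: 'd \<Rightarrow> nat. i \<in> multi_indices \<and> msize i = l}"
  have "(\<Prod>j\<in>UNIV. Lebesgue_const N u (i j)) \<le> L ^ CARD('d)" if "i \<in> ?A" for i
  proof -
    have "(\<Prod>j\<in>UNIV. Lebesgue_const N u (i j)) \<le> (\<Prod>j\<in>(UNIV :: 'd set). L)"
    proof (rule prod_mono)
      fix j
      \<comment> \<open>A size of at most q keeps every component in the range where
        \<open>L\<close> is assumed to be a bound.\<close>
      have "1 \<le> i j" "i j \<le> q - CARD('d) + 1"
        using that member_le_msize[of i j] \<open>l \<le> q\<close> by (auto simp: multi_indices_def)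
      then show "0 \<le> Lebesgue_const N u (i j) \<and> Lebesgue_const N u (i j) \<le> L"
        using nonneg le by blast
    qed
    then show ?thesis by simp
  qed
  then have "Lebesgue_sum TYPE('d) N u l \<le> real (card ?A) * L ^ CARD('d)"
    unfolding Lebesgue_sum_def by (rule sum_bounded_above)
  also have "real (card ?A) \<le> real ((q - CARD('d) + 1) ^ (CARD('d) - 1))"
    by (intro of_nat_mono card_multi_indices_eq_le \<open>l \<le> q\<close>)
  also have "\<dots> = (real (q - CARD('d)) + 1) ^ (CARD('d) - 1)"
    by (simp add: add.commute)
  finally show ?thesis
    using \<open>0 \<le> L\<close> by (simp add: mult_right_mono)
qed

section \<open>Lebesgue constants and tensor Lebesgue functions\<close>

text \<open>At a node the basis function belonging to it already contributes 1 to the Lebesgue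
  function.\<close>

lemma one_le_Lebesgue_const:
  assumes cont: "\<And>k. 1 \<le> k \<Longrightarrow> k \<le> N i \<Longrightarrow> continuous_on {0..1} (u i k)"
    and k: "1 \<le> k" "k \<le> N i" and t: "t \<in> {0..1}" "u i k t = 1"
  shows "1 \<le> Lebesgue_const N u i"
proof -
  have "1 = \<bar>u i k t\<bar>" using t by simp
  also have "\<dots> \<le> (\<Sum>k = 1..N i. \<bar>u i k t\<bar>)"
    using k by (intro member_le_sum) auto
  also have "\<dots> \<le> Lebesgue_const N u i"
    by (rule Lebesgue_const_is_max(2)) (use cont t in auto)
  finally show ?thesis .
qed

lemma sum_tensor_basis_le_prod_Lebesgue_const:
  fixes y :: "real ^ 'd::finite"
  assumes cont: "\<And>i k. 1 \<le> i \<Longrightarrow> 1 \<le> k \<Longrightarrow> k \<le> N i \<Longrightarrow> continuous_on {0..1} (u i k)"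
    and i: "i \<in> multi_indices" and y: "y \<in> cbox 0 1"
  shows "(\<Sum>k\<in>node_indices N i. \<bar>tensor_basis u i k y\<bar>) \<le> (\<Prod>j\<in>UNIV. Lebesgue_const N u (i j))"
  unfolding sum_abs_tensor_basis
proof (intro prod_mono conjI)
  fix j
  have "1 \<le> i j" using i by (simp add: multi_indices_def)
  moreover have "y $ j \<in> {0..1}" using y by (simp add: mem_box_cart)
  ultimately show "(\<Sum>k = 1..N (i j). \<bar>u (i j) k (y $ j)\<bar>) \<le> Lebesgue_const N u (i j)"
    using cont by (intro Lebesgue_const_is_max(2)) auto
qed (simp add: sum_nonneg)

section \<open>The error bound with explicit constants\<close>

text \<open>The weak bound \<open>M\<close> lets this serve both parts: a bound strictly below
  \<open>\<epsilon>\<close> gives (i), and \<open>M = \<epsilon>\<close> gives (ii). The absolute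
  value around \<open>sup_norm\<close> matches the quotient in (ii).\<close>

lemma abs_sup_norm_e_BVP_le:
  fixes V W :: "real ^ 'd::finite \<Rightarrow> real"
  assumes cont: "\<And>i k. 1 \<le> i \<Longrightarrow> 1 \<le> k \<Longrightarrow> k \<le> N i \<Longrightarrow> continuous_on {0..1} (u i k)"
    and M: "0 \<le> M" "\<And>i k. i \<in> multi_indices \<Longrightarrow> msize i \<le> q \<Longrightarrow> k \<in> node_indices N i \<Longrightarrow>
               \<bar>grid_error x V W i k\<bar> \<le> M"
  shows "\<bar>sup_norm (e_BVP N x u q V W)\<bar>
           \<le> M * (\<Sum>l = q - CARD('d) + 1..q.
                     real ((CARD('d) - 1) choose (q - l)) * Lebesgue_sum TYPE('d) N u l)"
    (is "_ \<le> M * ?S")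
proof -
  define B where "B l = real ((CARD('d) - 1) choose (q - l))" for l
  define A where "A = {i :: 'd \<Rightarrow> nat. i \<in> multi_indices \<and> q - CARD('d) + 1 \<le> msize i \<and> msize i \<le> q}"
  have B0: "0 \<le> B l" for l by (simp add: B_def)
  have finA: "finite A"
    unfolding A_def by (rule finite_subset[OF _ finite_multi_indices_le[of q]]) auto
  \<comment> \<open>Regroup by size: for l between q - d + 1 and q, the members of \<open>A\<close>
    of size l are exactly the multi-indices summed in S_l.\<close>
  have "?S = (\<Sum>l = q - CARD('d) + 1..q. \<Sum>i\<in>{i\<in>A. msize i = l}.
                B (msize i) * (\<Prod>j\<in>UNIV. Lebesgue_const N u (i j)))"
    unfolding Lebesgue_sum_def sum_distrib_left B_def A_def
    by (intro sum.cong refl) auto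
  also have "\<dots> = (\<Sum>i\<in>A. B (msize i) * (\<Prod>j\<in>UNIV. Lebesgue_const N u (i j)))"
    by (rule sum.group) (use finA in \<open>auto simp: A_def\<close>)
  finally have S: "?S = (\<Sum>i\<in>A. B (msize i) * (\<Prod>j\<in>UNIV. Lebesgue_const N u (i j)))" .
  have "\<bar>e_BVP N x u q V W y\<bar> \<le> M * ?S" if y: "y \<in> cbox 0 1" for y
  proof -
    have "\<bar>e_BVP N x u q V W y\<bar>
            \<le> (\<Sum>i\<in>A. \<Sum>k\<in>node_indices N i.
                 \<bar>(-1) ^ (q - msize i) * B (msize i) * grid_error x V W i k * tensor_basis u i k y\<bar>)"
      unfolding e_BVP_eq A_def[symmetric] B_def[symmetric]
      by (rule order_trans[OF sum_abs sum_mono[OF sum_abs]])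
    also have "\<dots> \<le> (\<Sum>i\<in>A. \<Sum>k\<in>node_indices N i. M * B (msize i) * \<bar>tensor_basis u i k y\<bar>)"
    proof (intro sum_mono)
      fix i k assume "i \<in> A" "k \<in> node_indices N i"
      then have "B (msize i) * \<bar>grid_error x V W i k\<bar> * \<bar>tensor_basis u i k y\<bar>
                   \<le> B (msize i) * M * \<bar>tensor_basis u i k y\<bar>"
        using M B0 by (intro mult_right_mono mult_left_mono) (auto simp: A_def)
      then show "\<bar>(-1) ^ (q - msize i) * B (msize i) * grid_error x V W i k * tensor_basis u i k y\<bar>
                   \<le> M * B (msize i) * \<bar>tensor_basis u i k y\<bar>"
        using B0 by (simp add: abs_mult power_abs mult_ac)
    qed
    also have "\<dots> = (\<Sum>i\<in>A. M * B (msize i) * (\<Sum>k\<in>node_indices N i. \<bar>tensor_basis u i k y\<bar>))"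
      by (simp add: sum_distrib_left)
    also have "\<dots> \<le> (\<Sum>i\<in>A. M * B (msize i) * (\<Prod>j\<in>UNIV. Lebesgue_const N u (i j)))"
      using M(1) B0 y
      by (intro sum_mono mult_left_mono sum_tensor_basis_le_prod_Lebesgue_const cont)
        (auto simp: A_def)
    also have "\<dots> = M * ?S"
      unfolding S by (simp add: sum_distrib_left mult.assoc)
    finally show ?thesis .
  qed
  \<comment> \<open>The supremum is taken over a nonempty set, so a bound on all its members bounds
    its absolute value.\<close>
  moreover have "(0 :: real ^ 'd) \<in> cbox 0 1" by (simp add: mem_box_cart)
  ultimately show ?thesis
    unfolding sup_norm_def by (intro cSup_abs_le) auto
qed

lemma finite_strict_bound:
  fixes f :: "'a \<Rightarrow> real"
  assumes "finite A" "0 < \<epsilon>" "\<And>a. a \<in> A \<Longrightarrow> f a < \<epsilon>"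
  obtains M where "0 \<le> M" "M < \<epsilon>" "\<And>a. a \<in> A \<Longrightarrow> f a \<le> M"
proof
  \<comment> \<open>Inserting 0 makes the maximum nonnegative and keeps it meaningful for empty
    \<open>A\<close>; it stays below \<open>\<epsilon>\<close> because \<open>\<epsilon>\<close> is
    positive.\<close>
  show "0 \<le> Max (insert 0 (f ` A))" "\<And>a. a \<in> A \<Longrightarrow> f a \<le> Max (insert 0 (f ` A))"
    using assms(1) by auto
  show "Max (insert 0 (f ` A)) < \<epsilon>"
    using assms by (subst Max_less_iff) auto
qed

lemma sup_norm_e_BVP_less:
  fixes V W :: "real ^ 'd::finite \<Rightarrow> real"
  assumes cont: "\<And>i k. 1 \<le> i \<Longrightarrow> 1 \<le> k \<Longrightarrow> k \<le> N i \<Longrightarrow> continuous_on {0..1} (u i k)"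
    and pos: "\<And>i. 1 \<le> i \<Longrightarrow> 0 < Lebesgue_const N u i"
    and q: "CARD('d) \<le> q" and "0 < \<epsilon>"
    and err: "\<And>i k. i \<in> multi_indices \<Longrightarrow> msize i \<le> q \<Longrightarrow> k \<in> node_indices N i \<Longrightarrow>
               \<bar>grid_error x V W i k\<bar> < \<epsilon>"
  shows "sup_norm (e_BVP N x u q V W)
           < \<epsilon> * (\<Sum>l = q - CARD('d) + 1..q.
                     real ((CARD('d) - 1) choose (q - l)) * Lebesgue_sum TYPE('d) N u l)"
    (is "_ < \<epsilon> * ?S")
proof -
  \<comment> \<open>All grid errors are indexed by one finite set of pairs, so a single
    \<open>M\<close> below \<open>\<epsilon>\<close> bounds them all.\<close>
  let ?A = "SIGMA i : {i. i \<in> multi_indices \<and> msize i \<le> q}. node_indices N i"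
  have "finite ?A"
    by (intro finite_SigmaI finite_multi_indices_le finite_node_indices)
  then obtain M where M: "0 \<le> M" "M < \<epsilon>"
      "\<And>a. a \<in> ?A \<Longrightarrow> \<bar>grid_error x V W (fst a) (snd a)\<bar> \<le> M"
    by (rule finite_strict_bound[OF _ \<open>0 < \<epsilon>\<close>, where f = "\<lambda>a. \<bar>grid_error x V W (fst a) (snd a)\<bar>"])
      (use err in auto)
  have "\<bar>grid_error x V W i k\<bar> \<le> M"
    if "i \<in> multi_indices" "msize i \<le> q" "k \<in> node_indices N i" for i k
    using M(3)[of "(i, k)"] that by simp
  with cont M(1) have "\<bar>sup_norm (e_BVP N x u q V W)\<bar> \<le> M * ?S"
    by (rule abs_sup_norm_e_BVP_le)
  moreover have "0 < ?S"
  \<comment> \<open>The term l = q has coefficient 1 and S_q > 0. The other terms are only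
    nonnegative: S_l is 0 when l < d, which can occur in the range if q < 2d - 1.\<close>
  proof (rule sum_pos2[of _ q])
    show "0 < real ((CARD('d) - 1) choose (q - q)) * Lebesgue_sum TYPE('d) N u q"
      using Lebesgue_sum_pos[OF pos q] by simp
    show "0 \<le> real ((CARD('d) - 1) choose (q - l)) * Lebesgue_sum TYPE('d) N u l" for l
      using pos by (intro mult_nonneg_nonneg Lebesgue_sum_nonneg) (auto intro: less_imp_le)
    show "q \<in> {q - CARD('d) + 1..q}"
      using q zero_less_card_finite[where 'a='d] by (simp; linarith)
  qed simp
  ultimately show ?thesis
    using mult_strict_right_mono[OF M(2), of ?S] by linarith
qed

section \<open>Asymptotic bound in q\<close>

text \<open>There are d levels l, each with a binomial coefficient of at most 2^(d - 1) and S_l at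
  most (q - d + 1)^(d - 1) L^d. It remains to compare q - d + 1 with the logarithm of 2^(q -
  d).\<close>

lemma binomial_Lebesgue_sum_le:
  assumes nonneg: "\<And>i. 1 \<le> i \<Longrightarrow> 0 \<le> Lebesgue_const N u i"
    and le: "\<And>i. 1 \<le> i \<Longrightarrow> i \<le> q - CARD('d) + 1 \<Longrightarrow> Lebesgue_const N u i \<le> L"
    and L: "0 \<le> L" and q: "CARD('d::finite) < q"
  shows "(\<Sum>l = q - CARD('d) + 1..q.
             real ((CARD('d) - 1) choose (q - l)) * Lebesgue_sum TYPE('d) N u l)
           \<le> real CARD('d) * 2 ^ (CARD('d) - 1) * (2 / ln 2) ^ (CARD('d) - 1) *
               (ln (2 ^ (q - CARD('d))) ^ (CARD('d) - 1) * L ^ CARD('d))"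
proof -
  let ?n = "real (q - CARD('d))" and ?d = "CARD('d)"
  have "(\<Sum>l = q - ?d + 1..q. real ((?d - 1) choose (q - l)) * Lebesgue_sum TYPE('d) N u l)
          \<le> real (card {q - ?d + 1..q}) * (2 ^ (?d - 1) * ((?n + 1) ^ (?d - 1) * L ^ ?d))"
  proof (rule sum_bounded_above)
    fix l assume "l \<in> {q - ?d + 1..q}"
    then have l: "l \<le> q" by simp
    have "real ((?d - 1) choose (q - l)) \<le> 2 ^ (?d - 1)"
      using binomial_le_pow2[of "?d - 1" "q - l"]
      by (metis of_nat_le_iff of_nat_numeral of_nat_power)
    then show "real ((?d - 1) choose (q - l)) * Lebesgue_sum TYPE('d) N u l
                 \<le> 2 ^ (?d - 1) * ((?n + 1) ^ (?d - 1) * L ^ ?d)"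
      using Lebesgue_sum_le[OF nonneg le L l] Lebesgue_sum_nonneg[OF nonneg]
      by (intro mult_mono) auto
  qed
  also have "card {q - ?d + 1..q} = ?d" using q by simp
  also have "(?n + 1) ^ (?d - 1) \<le> (2 / ln 2 * ln (2 ^ (q - ?d))) ^ (?d - 1)"
  proof (rule power_mono)
    \<comment> \<open>With n = q - d the right-hand side is 2n, which dominates n + 1 once n >= 1.
      At q = d the logarithm is 0 and the comparison fails.\<close>
    have "1 \<le> ?n" using q by simp
    then show "?n + 1 \<le> 2 / ln 2 * ln (2 ^ (q - ?d))"
      by (simp add: ln_realpow)
  qed simp
  also have "\<dots> = (2 / ln 2) ^ (?d - 1) * ln (2 ^ (q - ?d)) ^ (?d - 1)"
    by (rule power_mult_distrib)
  finally show ?thesis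
    using L by (simp only: mult.assoc) (simp add: mult_left_mono mult_right_mono)
qed

theorem theorem1:
  fixes N :: "nat \<Rightarrow> nat"
    and x :: "nat \<Rightarrow> nat \<Rightarrow> real"
    and u :: "nat \<Rightarrow> nat \<Rightarrow> real \<Rightarrow> real"
  assumes N_pos: "\<And>i. 1 \<le> i \<Longrightarrow> 1 \<le> N i"
    and nodes_distinct: "\<And>i. 1 \<le> i \<Longrightarrow> inj_on (x i) {1..N i}"
    and nodes_unit: "\<And>i. 1 \<le> i \<Longrightarrow> nodes N x i \<subseteq> {0..1}"
    and nodes_nested: "\<And>i. 1 < i \<Longrightarrow> nodes N x (i - 1) \<subseteq> nodes N x i"
    and basis_cont: "\<And>i k. 1 \<le> i \<Longrightarrow> 1 \<le> k \<Longrightarrow> k \<le> N i \<Longrightarrow> continuous_on {0..1} (u i k)"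
    and basis_one: "\<And>i k. 1 \<le> i \<Longrightarrow> 1 \<le> k \<Longrightarrow> k \<le> N i \<Longrightarrow> u i k (x i k) = 1"
    and basis_zero: "\<And>i k t. 1 \<le> i \<Longrightarrow> 1 \<le> k \<Longrightarrow> k \<le> N i \<Longrightarrow>
                       t \<in> nodes N x i \<Longrightarrow> t \<noteq> x i k \<Longrightarrow> u i k t = 0"
  shows "(\<forall>(q::nat) (\<epsilon>::real) (V :: real ^ 'd::finite \<Rightarrow> real) (W :: real ^ 'd \<Rightarrow> real).
            CARD('d) \<le> q \<longrightarrow> 0 < \<epsilon> \<longrightarrow>
            (\<forall>i\<in>multi_indices. msize i \<le> q \<longrightarrow>
               (\<forall>k\<in>node_indices N i. \<bar>grid_error x V W i k\<bar> < \<epsilon>)) \<longrightarrow>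
            sup_norm (e_BVP N x u q V W) <
              \<epsilon> * (\<Sum>l = q - CARD('d) + 1..q.
                     real ((CARD('d) - 1) choose (q - l)) * Lebesgue_sum TYPE('d) N u l))
       \<and> (\<exists>C>0. \<forall>\<^sub>F q in sequentially.
            \<forall>(\<epsilon>::real) (L::real) (V :: real ^ 'd \<Rightarrow> real) (W :: real ^ 'd \<Rightarrow> real).
              CARD('d) \<le> q \<longrightarrow> 0 < \<epsilon> \<longrightarrow>
              (\<forall>i\<in>multi_indices. msize i \<le> q \<longrightarrow>
                 (\<forall>k\<in>node_indices N i. \<bar>grid_error x V W i k\<bar> < \<epsilon>)) \<longrightarrow>
              0 < L \<longrightarrow>
              (\<forall>i. 1 \<le> i \<longrightarrow> i \<le> q - CARD('d) + 1 \<longrightarrow> Lebesgue_const N u i \<le> L) \<longrightarrow>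
              \<bar>sup_norm (e_BVP N x u q V W) / \<epsilon>\<bar> \<le>
                C * \<bar>(ln (2 ^ (q - CARD('d)))) ^ (CARD('d) - 1) * L ^ CARD('d)\<bar>)"
proof -
  \<comment> \<open>\<open>N_pos\<close> provides a first node on every level, at which the Lebesgue
    function is at least 1.\<close>
  have one_le: "1 \<le> Lebesgue_const N u i" if i: "1 \<le> i" for i
  proof (rule one_le_Lebesgue_const[where k = 1 and t = "x i 1"])
    show "1 \<le> N i" using N_pos[OF i] .
    then show "u i 1 (x i 1) = 1" and "x i 1 \<in> {0..1}"
      using basis_one[OF i, of 1] nodes_unit[OF i] unfolding nodes_def
      by (simp, blast intro: subsetD imageI atLeastAtMost_iff[THEN iffD2])
  qed (use basis_cont[OF i] in auto)
  have pos: "0 < Lebesgue_const N u i" if "1 \<le> i" for i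
    using one_le[OF that] by simp
  \<comment> \<open>The factors come from the number of levels, the binomial coefficients and the
    change from q - d + 1 to a logarithm. They depend on d alone, which gives uniformity in the
    errors, \<open>\<epsilon>\<close> and \<open>L\<close>.\<close>
  let ?C = "real CARD('d) * 2 ^ (CARD('d) - 1) * (2 / ln 2) ^ (CARD('d) - 1) :: real"
  have "\<bar>sup_norm (e_BVP N x u q V W) / \<epsilon>\<bar>
          \<le> ?C * \<bar>ln (2 ^ (q - CARD('d))) ^ (CARD('d) - 1) * L ^ CARD('d)\<bar>"
    if q: "CARD('d) < q" and \<epsilon>: "0 < \<epsilon>"
      and err: "\<forall>i\<in>multi_indices. msize i \<le> q \<longrightarrow>
                  (\<forall>k\<in>node_indices N i. \<bar>grid_error x V W i k\<bar> < \<epsilon>)"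
      and L: "0 < L" "\<forall>i. 1 \<le> i \<longrightarrow> i \<le> q - CARD('d) + 1 \<longrightarrow> Lebesgue_const N u i \<le> L"
    for q and \<epsilon> L :: real and V W :: "real ^ 'd \<Rightarrow> real"
  proof -
    have "\<bar>sup_norm (e_BVP N x u q V W) / \<epsilon>\<bar> = \<bar>sup_norm (e_BVP N x u q V W)\<bar> / \<epsilon>"
      using \<epsilon> by simp
    also have "\<dots> \<le> (\<Sum>l = q - CARD('d) + 1..q.
                   real ((CARD('d) - 1) choose (q - l)) * Lebesgue_sum TYPE('d) N u l)"
      using abs_sup_norm_e_BVP_le[of N u \<epsilon> q x V W] basis_cont \<epsilon> err
      by (simp add: pos_divide_le_eq mult.commute less_imp_le)
    also have "\<dots> \<le> ?C * (ln (2 ^ (q - CARD('d))) ^ (CARD('d) - 1) * L ^ CARD('d))"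
      using pos L q by (intro binomial_Lebesgue_sum_le) (auto intro: less_imp_le)
    also have "\<dots> \<le> ?C * \<bar>ln (2 ^ (q - CARD('d))) ^ (CARD('d) - 1) * L ^ CARD('d)\<bar>"
      by (intro mult_left_mono) auto
    finally show ?thesis .
  qed
  then have "\<exists>C>0. \<forall>\<^sub>F q in sequentially.
            \<forall>(\<epsilon>::real) (L::real) (V :: real ^ 'd \<Rightarrow> real) (W :: real ^ 'd \<Rightarrow> real).
              CARD('d) \<le> q \<longrightarrow> 0 < \<epsilon> \<longrightarrow>
              (\<forall>i\<in>multi_indices. msize i \<le> q \<longrightarrow>
                 (\<forall>k\<in>node_indices N i. \<bar>grid_error x V W i k\<bar> < \<epsilon>)) \<longrightarrow>
              0 < L \<longrightarrow>
              (\<forall>i. 1 \<le> i \<longrightarrow> i \<le> q - CARD('d) + 1 \<longrightarrow> Lebesgue_const N u i \<le> L) \<longrightarrow>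
              \<bar>sup_norm (e_BVP N x u q V W) / \<epsilon>\<bar> \<le>
                C * \<bar>(ln (2 ^ (q - CARD('d)))) ^ (CARD('d) - 1) * L ^ CARD('d)\<bar>"
    \<comment> \<open>"Eventually" means q > d here, where the logarithm is positive.\<close>
    by (intro exI[of _ ?C] conjI eventually_mono[OF eventually_gt_at_top[of "CARD('d)"]]) simp_all
  then show ?thesis
    using sup_norm_e_BVP_less[of N u, OF basis_cont pos] by blast
qed

end
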